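(* Assume $\xi_a\neq\xi_b$ and $\xi_a\neq\xi_b\pm\eta$ for all $a\ne b$. Let $M=N/2$ if $N$ is even and $M=(N-1)/2$ if $N$ is odd. Then $\tau(\lambda)$ is an eigenvalue of the antiperiodic transfer matrix $\mathcal T(\lambda)$ if and only if it can be written as $$\tau(\lambda)=\pm\tfrac12\big[p(\lambda-\eta)q(\lambda+\eta)-q(\lambda-\eta)p(\lambda+\eta)\big]$$ for some polynomial $q$ of degree $R\le M$ and some polynomial $p$ of degree $N-R$ such that $$\tfrac12\big[p(\lambda)q(\lambda-\eta)+q(\lambda)p(\lambda-\eta)\big]=d(\lambda).$$
   Context: Fix an integer $N\ge1$, a nonzero $\eta\in\mathbb C$ and complex inhomogeneity parameters $\xi_1,\dots,\xi_N$. Let $\mathbb V=\bigotimes_{n=1}^N V_n$ with $V_n\cong\mathbb C^2$. Let $R(\lambda)$ be the $4\times4$ matrix with rows $(\lambda+\eta,0,0,0)$, $(0,\lambda,\eta,0)$, $(0,\eta,\lambda,0)$, $(0,0,0,\lambda+\eta)$. The monodromy matrix is $T_0(\lambda)=R_{0N}(\lambda-\xi_N)\cdots R_{01}(\lambda-\xi_1)$ on $V_0\otimes\mathbb V$ ($V_0\cong\mathbb C^2$ auxiliary, $R_{0n}$ acting as $R$ on $V_0\otimes V_n$), written in $V_0$ as the $2\times2$ matrix with entries $A(\lambda),B(\lambda)$ (first row), $C(\lambda),D(\lambda)$ (second row). The antiperiodic transfer matrix is $\mathcal T(\lambda)=B(\lambda)+C(\lambda)=\mathrm{tr}_0(\sigma_0^xT_0(\lambda))$.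 Set $d(\lambda)=\prod_{n=1}^N(\lambda-\xi_n)$. A function $\tau(\lambda)$ is an eigenvalue of $\mathcal T$ if there is a nonzero $v\in\mathbb V$ with $\mathcal T(\lambda)v=\tau(\lambda)v$ for all $\lambda$. *)

theory Defs
  imports "HOL-Computational_Algebra.Polynomial"
begin

text \<open>Quantum space V = (C^2)^{\<otimes>N}: a basis state is a list of N booleans
 (False = first basis vector e_1, True = second basis vector e_2 of C^2);
 a vector is a function on basis states supported on lists of length N.
 Sites are numbered 0..N-1 (site n here is site n+1 of the paper), and
 the inhomogeneity of site n is xi n.\<close>

type_synonym state = "bool list \<Rightarrow> complex"

definition in_space :: "nat \<Rightarrow> state \<Rightarrow> bool" where
  "in_space N v \<longleftrightarrow> (\<forall>s. length s \<noteq> N \<longrightarrow> v s = 0)"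

text \<open>Elementary matrix E_ab = |a><b| acting on site n.\<close>
definition elem_op :: "nat \<Rightarrow> bool \<Rightarrow> bool \<Rightarrow> state \<Rightarrow> state" where
  "elem_op n a b v = (\<lambda>s. if n < length s \<and> s ! n = a then v (s[n := b]) else 0)"

text \<open>R(\<lambda>) = \<lambda> I + \<eta> P; as a 2x2 matrix in the auxiliary space V_0, the (i,j)
 entry of R_{0n}(\<lambda>) is \<lambda> \<delta>_ij + \<eta> E_ji acting on site n.\<close>
definition Rop :: "complex \<Rightarrow> nat \<Rightarrow> complex \<Rightarrow> bool \<Rightarrow> bool \<Rightarrow> state \<Rightarrow> state" where
  "Rop \<eta> n x i j v = (\<lambda>s. (if i = j then x * v s else 0) + \<eta> * elem_op n j i v s)"

fun monodromy :: "complex \<Rightarrow> (nat \<Rightarrow> complex) \<Rightarrow> nat \<Rightarrow> complex \<Rightarrow> bool \<Rightarrow> bool \<Rightarrow> state \<Rightarrow> state" where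
  "monodromy \<eta> \<xi> 0 x i j v = (if i = j then v else (\<lambda>s. 0))"
| "monodromy \<eta> \<xi> (Suc m) x i j v =
     (\<lambda>s. \<Sum>k\<in>(UNIV::bool set). Rop \<eta> m (x - \<xi> m) i k (monodromy \<eta> \<xi> m x k j v) s)"

definition opA where "opA \<eta> \<xi> N x = monodromy \<eta> \<xi> N x False False"
definition opB where "opB \<eta> \<xi> N x = monodromy \<eta> \<xi> N x False True"
definition opC where "opC \<eta> \<xi> N x = monodromy \<eta> \<xi> N x True False"
definition opD where "opD \<eta> \<xi> N x = monodromy \<eta> \<xi> N x True True"

definition antiperiodic_transfer :: "complex \<Rightarrow> (nat \<Rightarrow> complex) \<Rightarrow> nat \<Rightarrow> complex \<Rightarrow> state \<Rightarrow> state" where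
  "antiperiodic_transfer \<eta> \<xi> N x v = (\<lambda>s. opB \<eta> \<xi> N x v s + opC \<eta> \<xi> N x v s)"

definition is_transfer_eigenvalue :: "complex \<Rightarrow> (nat \<Rightarrow> complex) \<Rightarrow> nat \<Rightarrow> (complex \<Rightarrow> complex) \<Rightarrow> bool" where
  "is_transfer_eigenvalue \<eta> \<xi> N \<tau> \<longleftrightarrow>
     (\<exists>v. in_space N v \<and> v \<noteq> (\<lambda>s. 0) \<and>
          (\<forall>x. antiperiodic_transfer \<eta> \<xi> N x v = (\<lambda>s. \<tau> x * v s)))"

definition dfun :: "(nat \<Rightarrow> complex) \<Rightarrow> nat \<Rightarrow> complex \<Rightarrow> complex" where
  "dfun \<xi> N x = (\<Prod>n<N. (x - \<xi> n))"

end

theory Submission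
  imports Defs
begin

text \<open>
  The RTT relations, the quantum determinant and an antisymmetry of
  \<open>T(\<xi>\<^sub>n) T(\<xi>\<^sub>n - \<eta>)\<close> in the row indices all follow by induction on the number of sites.
  They give the fusion identity \<open>\<T>(\<xi>\<^sub>n) \<T>(\<xi>\<^sub>n - \<eta>) = - d(\<xi>\<^sub>n + \<eta>) d(\<xi>\<^sub>n - \<eta>)\<close>, so every eigenvalue
  is a polynomial of degree less than \<open>N\<close> satisfying these \<open>N\<close> discrete equations.

  Conversely, the covectors \<open>\<langle>h| = \<langle>0| \<Prod>\<^bsub>n\<in>h\<^esub> C(\<xi>\<^sub>n)\<close> are separated by the operators \<open>D(\<xi>\<^sub>n - \<eta>)\<close> and hence
  form a basis of the dual space (separation of variables). A solution \<open>\<tau>\<close> of the discrete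
  equations prescribes a vector by \<open>\<langle>h|v\<rangle> = \<Prod>\<^bsub>n\<in>h\<^esub> \<tau>(\<xi>\<^sub>n)\<close>; it is an eigenvector, because
  \<open>\<langle>h|\<T>(x)|v\<rangle> = \<tau>(x) \<langle>h|v\<rangle>\<close> holds at the \<open>N\<close> points \<open>\<xi>\<^sub>n - h\<^sub>n \<eta>\<close>, hence for all \<open>x\<close>.

  Finally, \<open>N\<close> linear equations in \<open>N + 1\<close> coefficients provide \<open>q \<noteq> 0\<close> of degree at most \<open>N\<close> such that
  \<open>\<tau> q = d q(\<cdot>+\<eta>) - d(\<cdot>+\<eta>) q(\<cdot>-\<eta>)\<close>: both sides agree at the \<open>2N\<close> points \<open>\<xi>\<^sub>n\<close>, \<open>\<xi>\<^sub>n - \<eta>\<close>. Likewise \<open>- \<tau>\<close>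
  yields \<open>p\<close>. The two equations make the quotient of \<open>p q(\<cdot>-\<eta>) + q p(\<cdot>-\<eta>)\<close> by \<open>d\<close> an \<open>\<eta>\<close>-periodic
  polynomial, so it is constant. Exchanging \<open>p\<close> and \<open>q\<close> flips the sign of \<open>\<tau>\<close>, which is how the
  bound on the degree of \<open>q\<close> is reached.
\<close>

section \<open>Relations of the monodromy matrix\<close>

text \<open>The permutation part of R swaps the auxiliary index with the state of site
  \<open>m\<close>, so a single \<open>k\<close> survives in the exchange term.\<close>

lemma monodromy_Suc:
  "monodromy \<eta> \<xi> (Suc m) x i j v s =
     (x - \<xi> m) * monodromy \<eta> \<xi> m x i j v s +
     (if m < length s then \<eta> * monodromy \<eta> \<xi> m x (s ! m) j v (s[m := i]) else 0)"
  by (cases i; cases "s ! m") (auto simp: Rop_def elem_op_def UNIV_bool)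

declare monodromy.simps(2) [simp del]

lemma monodromy_cong:
  assumes "\<And>t. length t = length s \<Longrightarrow> (\<And>k. m \<le> k \<Longrightarrow> k < length s \<Longrightarrow> t ! k = s ! k) \<Longrightarrow> v t = w t"
  shows "monodromy \<eta> \<xi> m x i j v s = monodromy \<eta> \<xi> m x i j w s"
  using assms
proof (induction m arbitrary: i s)
  case 0
  then show ?case by auto
next
  case (Suc m)
  have 1: "monodromy \<eta> \<xi> m x i j v s = monodromy \<eta> \<xi> m x i j w s"
    by (rule Suc.IH) (rule Suc.prems, auto)
  have 2: "monodromy \<eta> \<xi> m x (s ! m) j v (s[m := i]) = monodromy \<eta> \<xi> m x (s ! m) j w (s[m := i])"
    by (rule Suc.IH) (rule Suc.prems, auto)
  show ?case by (simp only: monodromy_Suc 1 2)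
qed

lemma monodromy_linear:
  "monodromy \<eta> \<xi> m x i j (\<lambda>s. a * f s + b * g s) s =
     a * monodromy \<eta> \<xi> m x i j f s + b * monodromy \<eta> \<xi> m x i j g s"
  by (induction m arbitrary: i s) (auto simp: monodromy_Suc algebra_simps)

lemma monodromy_list_update:
  "m \<le> n \<Longrightarrow> monodromy \<eta> \<xi> m x i j (\<lambda>s. f (s[n := c])) s = monodromy \<eta> \<xi> m x i j f (s[n := c])"
  by (induction m arbitrary: i s) (auto simp: monodromy_Suc list_update_swap)

lemma in_space_monodromy:
  assumes "in_space N v"
  shows "in_space N (monodromy \<eta> \<xi> m x i j v)"
  unfolding in_space_def
proof (intro allI impI)
  fix s :: "bool list" assume s: "length s \<noteq> N"
  have "monodromy \<eta> \<xi> m x i j v s = monodromy \<eta> \<xi> m x i j (\<lambda>s. 0 * v s + 0 * v s) s"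
    by (rule monodromy_cong) (use assms s in \<open>auto simp: in_space_def\<close>)
  then show "monodromy \<eta> \<xi> m x i j v s = 0"
    unfolding monodromy_linear by simp
qed

lemma monodromy_monodromy_Suc:
  "monodromy \<eta> \<xi> m x i j (monodromy \<eta> \<xi> (Suc m) y k l v) s =
     (y - \<xi> m) * monodromy \<eta> \<xi> m x i j (monodromy \<eta> \<xi> m y k l v) s +
     (if m < length s
      then \<eta> * monodromy \<eta> \<xi> m x i j (monodromy \<eta> \<xi> m y (s ! m) l v) (s[m := k]) else 0)"
proof -
  define e where "e = (if m < length s then \<eta> else 0)"
  have "monodromy \<eta> \<xi> m x i j (monodromy \<eta> \<xi> (Suc m) y k l v) s =
    monodromy \<eta> \<xi> m x i j (\<lambda>t. (y - \<xi> m) * monodromy \<eta> \<xi> m y k l v t +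
       e * monodromy \<eta> \<xi> m y (s ! m) l v (t[m := k])) s"
    by (rule monodromy_cong) (auto simp: monodromy_Suc e_def)
  then show ?thesis
    unfolding monodromy_linear by (simp add: monodromy_list_update e_def)
qed

text \<open>The terms record identity or exchange at site \<open>m\<close> in either factor; in the
  last one the inner factor reads the \<open>i\<close> written by the outer one. The next three
  inductions rest on this.\<close>

lemma monodromy_Suc_monodromy_Suc:
  "monodromy \<eta> \<xi> (Suc m) x i j (monodromy \<eta> \<xi> (Suc m) y k l v) s =
    (x - \<xi> m) * (y - \<xi> m) * monodromy \<eta> \<xi> m x i j (monodromy \<eta> \<xi> m y k l v) s +
    (if m < length s then
      (x - \<xi> m) * \<eta> * monodromy \<eta> \<xi> m x i j (monodromy \<eta> \<xi> m y (s ! m) l v) (s[m := k]) +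
      \<eta> * (y - \<xi> m) * monodromy \<eta> \<xi> m x (s ! m) j (monodromy \<eta> \<xi> m y k l v) (s[m := i]) +
      \<eta> ^ 2 * monodromy \<eta> \<xi> m x (s ! m) j (monodromy \<eta> \<xi> m y i l v) (s[m := k]) else 0)"
  by (simp add: monodromy_Suc[of _ _ _ x] monodromy_monodromy_Suc algebra_simps power2_eq_square)

text \<open>Componentwise intertwining by \<open>(x - y) + \<eta> P\<close>. A new site multiplies
  from the left, so the columns \<open>j\<close>, \<open>l\<close> stay fixed in the
  induction.\<close>

lemma RTT:
  "(x - y) * monodromy \<eta> \<xi> m x i j (monodromy \<eta> \<xi> m y k l v) s
     + \<eta> * monodromy \<eta> \<xi> m x k j (monodromy \<eta> \<xi> m y i l v) s =
   (x - y) * monodromy \<eta> \<xi> m y k l (monodromy \<eta> \<xi> m x i j v) s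
     + \<eta> * monodromy \<eta> \<xi> m y k j (monodromy \<eta> \<xi> m x i l v) s"
proof (induction m arbitrary: i k s)
  case 0
  show ?case by auto
next
  case (Suc m)
  define c where "c = s ! m"
  define X where "X = x - \<xi> m"
  define Y where "Y = y - \<xi> m"
  define F where "F a b t = monodromy \<eta> \<xi> m x a j (monodromy \<eta> \<xi> m y b l v) t" for a b t
  define G where "G b a t = monodromy \<eta> \<xi> m y b l (monodromy \<eta> \<xi> m x a j v) t" for a b t
  define H where "H b a t = monodromy \<eta> \<xi> m y b j (monodromy \<eta> \<xi> m x a l v) t" for a b t
  have xy: "x - y = X - Y" by (simp add: X_def Y_def)
  have IH: "(X - Y) * F a b t + \<eta> * F b a t = (X - Y) * G b a t + \<eta> * H b a t" for a b t
    using Suc.IH[of a b t] by (simp add: F_def G_def H_def xy)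
  show ?case
  proof (cases "m < length s")
    case False
    then show ?thesis using IH[of i k s]
      unfolding monodromy_Suc_monodromy_Suc xy
      unfolding F_def[symmetric] G_def[symmetric] H_def[symmetric] X_def[symmetric] Y_def[symmetric]
      by simp algebra
  next
    case True
    have "(X - Y) * (X * Y * F i k s + X * \<eta> * F i c (s[m := k]) + \<eta> * Y * F c k (s[m := i])
           + \<eta>^2 * F c i (s[m := k]))
        + \<eta> * (X * Y * F k i s + X * \<eta> * F k c (s[m := i]) + \<eta> * Y * F c i (s[m := k])
           + \<eta>^2 * F c k (s[m := i])) =
      (X - Y) * (Y * X * G k i s + Y * \<eta> * G k c (s[m := i]) + \<eta> * X * G c i (s[m := k])
           + \<eta>^2 * G c k (s[m := i]))
        + \<eta> * (Y * X * H k i s + Y * \<eta> * H k c (s[m := i]) + \<eta> * X * H c i (s[m := k])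
           + \<eta>^2 * H c k (s[m := i]))"
      using IH[of i k s] IH[of i c "s[m := k]"] IH[of c k "s[m := i]"] 
            IH[of c i "s[m := k]"] IH[of k c "s[m := i]"]
      by algebra
    with True show ?thesis
      unfolding monodromy_Suc_monodromy_Suc xy
      unfolding F_def[symmetric] G_def[symmetric] H_def[symmetric] X_def[symmetric] Y_def[symmetric]
        c_def[symmetric]
      by (simp add: add.assoc)
  qed
qed


text \<open>Each new site preserves the antisymmetric symbol \<open>\<epsilon>\<close> in the rows
  and multiplies it by \<open>(X + \<eta>) * (X - \<eta>)\<close>.\<close>

lemma quantum_determinant:
  assumes "m \<le> length s"
  shows "monodromy \<eta> \<xi> m x j True (monodromy \<eta> \<xi> m (x - \<eta>) i False v) s
     - monodromy \<eta> \<xi> m x j False (monodromy \<eta> \<xi> m (x - \<eta>) i True v) s =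
   (if i = j then 0 else if j then 1 else -1) * dfun \<xi> m (x + \<eta>) * dfun \<xi> m (x - \<eta>) * v s"
  using assms
proof (induction m arbitrary: i j s)
  case 0
  show ?case by (auto simp: dfun_def)
next
  case (Suc m)
  define c where "c = s ! m"
  define X where "X = x - \<xi> m"
  define F where "F a b t = monodromy \<eta> \<xi> m x a True (monodromy \<eta> \<xi> m (x - \<eta>) b False v) t" for a b t
  define G where "G a b t = monodromy \<eta> \<xi> m x a False (monodromy \<eta> \<xi> m (x - \<eta>) b True v) t" for a b t
  define q where "q = dfun \<xi> m (x + \<eta>) * dfun \<xi> m (x - \<eta>)"
  define \<epsilon> :: "bool \<Rightarrow> bool \<Rightarrow> complex" where "\<epsilon> a b = (if a = b then 0 else if a then 1 else -1)" for a b
  have IH: "F a b t = G a b t + \<epsilon> a b * q * v t" if "length t = length s" for a b t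
    using Suc.IH[of t a b] Suc.prems that
    by (simp add: F_def G_def q_def \<epsilon>_def algebra_simps split: if_splits)
  have y: "x - \<eta> - \<xi> m = X - \<eta>" by (simp add: X_def)
  have q': "dfun \<xi> (Suc m) (x + \<eta>) * dfun \<xi> (Suc m) (x - \<eta>) = q * (X + \<eta>) * (X - \<eta>)"
    by (simp add: dfun_def q_def X_def algebra_simps)
  have "s[m := c] = s" by (simp add: c_def)
  \<comment> \<open>Antisymmetrising over three indices with two values gives zero; this is that
    identity for \<open>j\<close>, \<open>c\<close>, \<open>i\<close>.\<close>
  then have e: "\<epsilon> j c * v (s[m := i]) + \<epsilon> c i * v (s[m := j]) = \<epsilon> j i * v s" and e': "\<epsilon> c j = - \<epsilon> j c"
    by (cases c; cases i; cases j; simp add: \<epsilon>_def)+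
  have "X * (X - \<eta>) * F j i s + (X * \<eta> * F j c (s[m := i]) + \<eta> * (X - \<eta>) * F c i (s[m := j]) + \<eta>^2 * F c j (s[m := i]))
    - (X * (X - \<eta>) * G j i s + (X * \<eta> * G j c (s[m := i]) + \<eta> * (X - \<eta>) * G c i (s[m := j]) + \<eta>^2 * G c j (s[m := i])))
    = \<epsilon> j i * (q * (X + \<eta>) * (X - \<eta>)) * v s"
    using e by (simp add: IH e') algebra
  with Suc.prems show ?case
    unfolding monodromy_Suc_monodromy_Suc y mult.assoc[of _ "dfun _ _ _"] q'
    unfolding F_def[symmetric] G_def[symmetric] X_def[symmetric] c_def[symmetric] \<epsilon>_def[symmetric]
    by (simp add: \<epsilon>_def)
qed

text \<open>At these two points the R-matrices of site \<open>n\<close> produce an antisymmetriser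
  of the rows, and later sites preserve the antisymmetry.\<close>

lemma monodromy_antisymmetric:
  assumes "n < m" "m \<le> length s"
  shows "monodromy \<eta> \<xi> m (\<xi> n) i j (monodromy \<eta> \<xi> m (\<xi> n - \<eta>) k l v) s =
       - monodromy \<eta> \<xi> m (\<xi> n) k j (monodromy \<eta> \<xi> m (\<xi> n - \<eta>) i l v) s"
  using assms
proof (induction m arbitrary: i k s)
  case 0
  then show ?case by simp
next
  case (Suc m)
  define c where "c = s ! m"
  define X where "X = \<xi> n - \<xi> m"
  define F where "F a b t = monodromy \<eta> \<xi> m (\<xi> n) a j (monodromy \<eta> \<xi> m (\<xi> n - \<eta>) b l v) t" for a b t
  have y: "\<xi> n - \<eta> - \<xi> m = X - \<eta>" by (simp add: X_def)
  have "X * (X - \<eta>) * F i k s + (X * \<eta> * F i c (s[m := k]) + \<eta> * (X - \<eta>) * F c k (s[m := i]) + \<eta>^2 * F c i (s[m := k])) =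
     - (X * (X - \<eta>) * F k i s + (X * \<eta> * F k c (s[m := i]) + \<eta> * (X - \<eta>) * F c i (s[m := k]) + \<eta>^2 * F c k (s[m := i])))"
  proof (cases "n = m")
    case True
    \<comment> \<open>Here \<open>X = 0\<close> leaves two \<open>\<eta>^2\<close> terms, which
      swapping \<open>i\<close> and \<open>k\<close> exchanges with a sign.\<close>
    then show ?thesis by (simp add: X_def power2_eq_square)
  next
    case False
    have IH: "F a b t = - F b a t" if "length t = length s" for a b t
      using Suc.IH[of t a b] Suc.prems that False by (simp add: F_def)
    have 1: "F i k s = - F k i s" "F i c (s[m := k]) = - F c i (s[m := k])"
      "F k c (s[m := i]) = - F c k (s[m := i])" by (rule IH; simp)+
    show ?thesis unfolding 1 by algebra
  qed
  with Suc.prems show ?case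
    unfolding monodromy_Suc_monodromy_Suc y
    unfolding F_def[symmetric] X_def[symmetric] c_def[symmetric]
    by simp
qed

text \<open>Evaluation at such \<open>s\<close> pairs with the vacuum covector on the first
  \<open>m\<close> sites. B comes first, since the exchange term of D is a B entry.\<close>

lemma monodromy_vacuum:
  assumes "\<And>k. k < m \<Longrightarrow> k < length s \<and> \<not> s ! k"
  shows "monodromy \<eta> \<xi> m x False True v s = 0"
    and "monodromy \<eta> \<xi> m x True True v s = dfun \<xi> m x * v s"
proof -
  have B: "monodromy \<eta> \<xi> m x False True v s = 0" if "\<And>k. k < m \<Longrightarrow> k < length s \<and> \<not> s ! k" for m s
    using that
  proof (induction m arbitrary: s)
    case (Suc m)
    have "monodromy \<eta> \<xi> m x False True v (s[m := False]) = 0"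
      by (rule Suc.IH) (use Suc.prems in \<open>auto simp: less_Suc_eq\<close>)
    with Suc show ?case by (auto simp: monodromy_Suc less_Suc_eq)
  qed simp
  show "monodromy \<eta> \<xi> m x False True v s = 0" using assms by (rule B)
  show "monodromy \<eta> \<xi> m x True True v s = dfun \<xi> m x * v s"
    using assms
  proof (induction m)
    case 0
    show ?case by (simp add: dfun_def)
  next
    case (Suc m)
    have "monodromy \<eta> \<xi> m x False True v (s[m := True]) = 0"
      by (rule B) (use Suc.prems in \<open>auto simp: less_Suc_eq\<close>)
    with Suc show ?case by (auto simp: monodromy_Suc less_Suc_eq dfun_def)
  qed
qed

text \<open>The power \<open>x^m\<close> arises only from the identity parts of all R-matrices,
  which are diagonal in the auxiliary space.\<close>

lemma monodromy_polynomial: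
  "\<exists>P. degree P \<le> m \<and> (i \<noteq> j \<longrightarrow> coeff P m = 0) \<and> (\<forall>x. monodromy \<eta> \<xi> m x i j v s = poly P x)"
proof (induction m arbitrary: i s)
  case 0
  show ?case by (rule exI[of _ "[:if i = j then v s else 0:]"]) auto
next
  case (Suc m)
  obtain P where P: "degree P \<le> m" "i \<noteq> j \<longrightarrow> coeff P m = 0"
    "\<And>x. monodromy \<eta> \<xi> m x i j v s = poly P x"
    using Suc[of i s] by blast
  obtain Q where Q: "degree Q \<le> m" "\<And>x. monodromy \<eta> \<xi> m x (s ! m) j v (s[m := i]) = poly Q x"
    using Suc[of "s ! m" "s[m := i]"] by blast
  let ?P = "[:- \<xi> m, 1:] * P + smult (if m < length s then \<eta> else 0) Q"
  have 1: "degree ([:- \<xi> m, 1:] * P) \<le> Suc m"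
    using degree_mult_le[of "[:- \<xi> m, 1:]" P] P(1) by auto
  have "degree ?P \<le> Suc m"
    by (rule degree_add_le[OF 1]) (use Q(1) in \<open>auto intro: order_trans[OF degree_smult_le]\<close>)
  moreover have "i \<noteq> j \<longrightarrow> coeff ?P (Suc m) = 0"
    using P(1,2) Q(1) by (auto simp: coeff_eq_0)
  moreover have "\<forall>x. monodromy \<eta> \<xi> (Suc m) x i j v s = poly ?P x"
    by (auto simp: monodromy_Suc P(3) Q(2) algebra_simps)
  ultimately show ?case by blast
qed

section \<open>Finite linear systems\<close>

text \<open>Gaussian elimination: the pivot \<open>w\<close> of equation \<open>e\<close> is
  eliminated from the others, and \<open>b\<close> restores it by back substitution.\<close>

lemma underdetermined_system:
  fixes M :: "'a \<Rightarrow> 'b \<Rightarrow> 'c :: field"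
  assumes "finite E" "finite U" "card E < card U"
  shows "\<exists>a. (\<exists>u\<in>U. a u \<noteq> 0) \<and> (\<forall>e\<in>E. (\<Sum>u\<in>U. M e u * a u) = 0)"
  using assms
proof (induction E arbitrary: M U rule: finite_induct)
  case empty
  then have "U \<noteq> {}" by auto
  then show ?case by (intro exI[of _ "\<lambda>_. 1"]) auto
next
  case (insert e E)
  show ?case
  proof (cases "\<forall>u\<in>U. M e u = 0")
    case True
    then show ?thesis using insert.IH[of U M] insert.prems insert.hyps by auto
  next
    case False
    then obtain w where w: "w \<in> U" "M e w \<noteq> 0" by auto
    define M' where "M' f u = M f u - M f w * M e u / M e w" for f u
    have "card E < card (U - {w})" using insert.prems insert.hyps w by simp
    then obtain a where a: "\<exists>u\<in>U - {w}. a u \<noteq> 0" "\<forall>f\<in>E. (\<Sum>u\<in>U - {w}. M' f u * a u) = 0"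
      using insert.IH[of "U - {w}" M'] insert.prems by auto
    define S where "S f = (\<Sum>u\<in>U - {w}. M f u * a u)" for f
    define b where "b = a(w := - S e / M e w)"
    have sum_b: "(\<Sum>u\<in>U. M f u * b u) = S f - M f w * S e / M e w" for f
    proof -
      have "(\<Sum>u\<in>U. M f u * b u) = M f w * b w + (\<Sum>u\<in>U - {w}. M f u * b u)"
        using w insert.prems by (simp add: sum.remove)
      also have "(\<Sum>u\<in>U - {w}. M f u * b u) = S f"
        unfolding S_def by (rule sum.cong) (auto simp: b_def)
      finally show ?thesis by (simp add: b_def)
    qed
    have "S f - M f w * S e / M e w = (\<Sum>u\<in>U - {w}. M' f u * a u)" for f
      by (simp add: S_def M'_def sum_distrib_left sum_divide_distrib left_diff_distrib
          sum_subtractf mult.assoc)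
    with a(2) sum_b have "\<forall>f\<in>E. (\<Sum>u\<in>U. M f u * b u) = 0"
      by simp
    moreover have "(\<Sum>u\<in>U. M e u * b u) = 0"
      unfolding sum_b using w(2) by simp
    moreover have "\<exists>u\<in>U. b u \<noteq> 0" using a(1) by (auto simp: b_def)
    ultimately show ?thesis by blast
  qed
qed

text \<open>The right-hand side becomes the column of an extra unknown \<open>None\<close>, making
  the homogeneous system underdetermined. Injectivity forces that unknown to be nonzero, so one can
  divide by it.\<close>

lemma injective_imp_solvable:
  fixes M :: "'a \<Rightarrow> 'b \<Rightarrow> 'c :: field"
  assumes fin: "finite H" "finite S" and card: "card H = card S"
    and inj: "\<And>v. (\<And>h. h \<in> H \<Longrightarrow> (\<Sum>s\<in>S. M h s * v s) = 0) \<Longrightarrow> \<forall>s\<in>S. v s = 0"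
  shows "\<exists>v. \<forall>h\<in>H. (\<Sum>s\<in>S. M h s * v s) = b h"
proof -
  define U where "U = insert None (Some ` S)"
  define M' where "M' h u = (case u of None \<Rightarrow> b h | Some s \<Rightarrow> M h s)" for h u
  have sum_U: "(\<Sum>u\<in>U. M' h u * a u) = b h * a None + (\<Sum>s\<in>S. M h s * a (Some s))" for h a
    using fin by (simp add: U_def M'_def sum.reindex)
  have "card H < card U"
    using fin card by (simp add: U_def card_image)
  then obtain a where a: "\<exists>u\<in>U. a u \<noteq> 0" "\<forall>h\<in>H. (\<Sum>u\<in>U. M' h u * a u) = 0"
    using underdetermined_system[of H U M'] fin by (auto simp: U_def)
  have "a None \<noteq> 0"
  proof
    assume 0: "a None = 0"
    then have "\<forall>s\<in>S. a (Some s) = 0"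
      using a(2) by (intro inj) (auto simp: sum_U)
    with 0 a(1) show False by (auto simp: U_def)
  qed
  have "(\<Sum>s\<in>S. M h s * (- a (Some s) / a None)) = b h" if "h \<in> H" for h
  proof -
    have "(\<Sum>s\<in>S. M h s * (- a (Some s) / a None)) = - (\<Sum>s\<in>S. M h s * a (Some s)) / a None"
      by (simp add: sum_negf sum_divide_distrib)
    also have "\<dots> = b h"
      using add.inverse_unique[OF bspec[OF a(2) that, unfolded sum_U]] \<open>a None \<noteq> 0\<close>
      by (simp flip: \<open>- (b h * a None) = _\<close>)
    finally show ?thesis .
  qed
  then show ?thesis by (intro exI[of _ "\<lambda>s. - a (Some s) / a None"] ballI)
qed

text \<open>The transposed system is solvable; its solution for the unit vector at \<open>s\<close>
  combines the rows so as to extract \<open>v s\<close>.\<close>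

lemma independent_rows_imp_injective:
  fixes M :: "'a \<Rightarrow> 'b \<Rightarrow> 'c :: field"
  assumes fin: "finite H" "finite S" and card: "card H = card S"
    and rows: "\<And>a. (\<And>s. s \<in> S \<Longrightarrow> (\<Sum>h\<in>H. a h * M h s) = 0) \<Longrightarrow> \<forall>h\<in>H. a h = 0"
    and v: "\<And>h. h \<in> H \<Longrightarrow> (\<Sum>s\<in>S. M h s * v s) = 0" and "s \<in> S"
  shows "v s = 0"
proof -
  have "\<exists>a. \<forall>t\<in>S. (\<Sum>h\<in>H. M h t * a h) = (if t = s then 1 else 0)"
    by (rule injective_imp_solvable) (use fin card rows in \<open>auto simp: mult.commute\<close>)
  then obtain a where a: "\<And>t. t \<in> S \<Longrightarrow> (\<Sum>h\<in>H. M h t * a h) = (if t = s then 1 else 0)" by blast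
  have "v s = (\<Sum>t\<in>S. (\<Sum>h\<in>H. M h t * a h) * v t)"
    using a fin \<open>s \<in> S\<close> by (simp add: sum.delta' if_distrib[of "\<lambda>x. x * _"] cong: if_cong)
  also have "\<dots> = (\<Sum>h\<in>H. a h * (\<Sum>t\<in>S. M h t * v t))"
    unfolding sum_distrib_left sum_distrib_right by (subst sum.swap) (simp add: mult_ac)
  also have "\<dots> = 0" using v by simp
  finally show ?thesis .
qed

section \<open>Shifted polynomials\<close>

lemma degree_less_if_coeff_0:
  assumes "degree p \<le> n" "coeff p n = 0" "0 < n"
  shows "degree p < n"
  using assms by (metis degree_0 le_neq_implies_less leading_coeff_0_iff)

definition shift :: "complex \<Rightarrow> complex poly \<Rightarrow> complex poly" where
  "shift c p = pcompose p [:c, 1:]"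

lemma poly_shift [simp]: "poly (shift c p) x = poly p (x + c)"
  by (simp add: shift_def poly_pcompose add.commute)

lemma degree_shift [simp]: "degree (shift c p) = degree p"
  by (simp add: shift_def degree_pcompose)

lemma coeff_shift_top: "degree p \<le> n \<Longrightarrow> coeff (shift c p) n = coeff p n"
  using lead_coeff_comp[of "[:c, 1:]" p] degree_shift[of c p]
  by (cases "degree p = n") (auto simp: shift_def coeff_eq_0)

text \<open>Bounds in place of exact degrees let top terms cancel without case distinctions.\<close>

lemma coeff_mult_top:
  fixes p q :: "'a :: comm_semiring_0 poly"
  assumes "degree p \<le> a" "degree q \<le> b"
  shows "coeff (p * q) (a + b) = coeff p a * coeff q b"
proof (cases "degree p = a \<and> degree q = b")
  case True
  then show ?thesis using coeff_mult_degree_sum[of p q] by auto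
next
  case False
  then have "degree (p * q) < a + b" "coeff p a = 0 \<or> coeff q b = 0"
    using assms degree_mult_le[of p q] by (auto simp: coeff_eq_0)
  then show ?thesis by (auto simp: coeff_eq_0)
qed

lemma periodic_poly_constant:
  assumes "c \<noteq> 0" "shift c w = w"
  shows "\<exists>k. w = [:k:]"
proof -
  have "poly w (of_nat n * c) = poly w 0" for n
  proof (induction n)
    case (Suc n)
    have "poly w (of_nat n * c + c) = poly w (of_nat n * c)"
      using arg_cong[OF assms(2), of "\<lambda>w. poly w (of_nat n * c)"] by simp
    with Suc show ?case by (simp add: algebra_simps)
  qed simp
  then have "range (\<lambda>n. of_nat n * c) \<subseteq> {x. poly (w - [:poly w 0:]) x = 0}" by auto
  moreover have "infinite (range (\<lambda>n. of_nat n * c))"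
    using assms(1) by (intro range_inj_infinite) (auto simp: inj_on_def)
  ultimately have "w - [:poly w 0:] = 0"
    using poly_roots_finite[of "w - [:poly w 0:]"] finite_subset by blast
  then show ?thesis by (intro exI[of _ "poly w 0"]) simp
qed

section \<open>Fusion and separation of variables\<close>

locale inhomogeneous_chain =
  fixes N :: nat and \<eta> :: complex and \<xi> :: "nat \<Rightarrow> complex"
  assumes N_pos: "N \<ge> 1" and eta_nonzero: "\<eta> \<noteq> 0"
    and generic: "\<And>a b. a < N \<Longrightarrow> b < N \<Longrightarrow> a \<noteq> b \<Longrightarrow>
           \<xi> a \<noteq> \<xi> b \<and> \<xi> a \<noteq> \<xi> b + \<eta> \<and> \<xi> a \<noteq> \<xi> b - \<eta>"
begin

section \<open>Operators at the nodes and the fusion identity\<close>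

abbreviation "B \<equiv> opB \<eta> \<xi> N"
abbreviation "C \<equiv> opC \<eta> \<xi> N"
abbreviation "D \<equiv> opD \<eta> \<xi> N"
abbreviation "\<T> \<equiv> antiperiodic_transfer \<eta> \<xi> N"
abbreviation "d \<equiv> dfun \<xi> N"

text \<open>The quantum determinant at \<open>\<xi> n\<close>.\<close>

definition detq :: "nat \<Rightarrow> complex" where
  "detq n = d (\<xi> n + \<eta>) * d (\<xi> n - \<eta>)"

lemma d_node [simp]: "n < N \<Longrightarrow> d (\<xi> n) = 0"
  by (auto simp: dfun_def)

lemma shifted_node_neq: "n < N \<Longrightarrow> m < N \<Longrightarrow> \<xi> n - \<eta> \<noteq> \<xi> m"
  using generic[of n m] eta_nonzero by (cases "n = m") (auto simp: algebra_simps)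

lemma d_shifted_node_nonzero:
  assumes "n < N" shows "d (\<xi> n + \<eta>) \<noteq> 0" "d (\<xi> n - \<eta>) \<noteq> 0"
proof -
  have "\<xi> n + \<eta> - \<xi> m \<noteq> 0" "\<xi> n - \<eta> - \<xi> m \<noteq> 0" if "m < N" for m
    using shifted_node_neq[OF assms that] shifted_node_neq[OF that assms] by (auto simp: algebra_simps)
  then show "d (\<xi> n + \<eta>) \<noteq> 0" "d (\<xi> n - \<eta>) \<noteq> 0" by (auto simp: dfun_def)
qed

lemma detq_nonzero: "n < N \<Longrightarrow> detq n \<noteq> 0"
  by (simp add: detq_def d_shifted_node_nonzero)

text \<open>The factors \<open>1\<close> give the shape on which the linearity lemmas match.\<close>

lemma transfer_eq: "\<T> x v = (\<lambda>s. 1 * B x v s + 1 * C x v s)"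
  by (simp add: antiperiodic_transfer_def)

lemma in_space_ops:
  assumes "in_space N v"
  shows "in_space N (B x v)" "in_space N (C x v)" "in_space N (D x v)" "in_space N (\<T> x v)"
  using in_space_monodromy[OF assms]
  by (auto simp: opB_def opC_def opD_def antiperiodic_transfer_def in_space_def)

text \<open>BB and CC vanish, having equal rows; antisymmetry turns BC into -DA, and CB - DA is
  minus the quantum determinant.\<close>

lemma fusion:
  assumes "n < N" "length s = N"
  shows "\<T> (\<xi> n) (\<T> (\<xi> n - \<eta>) v) s = - detq n * v s"
proof -
  note anti = monodromy_antisymmetric[OF assms(1), of s \<eta> \<xi>]
  have "\<T> (\<xi> n) (\<T> (\<xi> n - \<eta>) v) s =
      B (\<xi> n) (B (\<xi> n - \<eta>) v) s + B (\<xi> n) (C (\<xi> n - \<eta>) v) s +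
      (C (\<xi> n) (B (\<xi> n - \<eta>) v) s + C (\<xi> n) (C (\<xi> n - \<eta>) v) s)"
    unfolding transfer_eq unfolding opB_def opC_def monodromy_linear by simp
  also have "B (\<xi> n) (B (\<xi> n - \<eta>) v) s = 0"
    using anti[of False True False True v] assms by (simp add: opB_def eq_neg_iff_add_eq_0)
  also have "C (\<xi> n) (C (\<xi> n - \<eta>) v) s = 0"
    using anti[of True False True False v] assms by (simp add: opC_def eq_neg_iff_add_eq_0)
  also have "B (\<xi> n) (C (\<xi> n - \<eta>) v) s = - D (\<xi> n) (opA \<eta> \<xi> N (\<xi> n - \<eta>) v) s"
    using anti[of False True True False v] assms by (simp add: opA_def opB_def opC_def opD_def)
  also have "0 + - D (\<xi> n) (opA \<eta> \<xi> N (\<xi> n - \<eta>) v) s + (C (\<xi> n) (B (\<xi> n - \<eta>) v) s + 0)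
     = - detq n * v s"
    using quantum_determinant[of N s \<eta> \<xi> "\<xi> n" True False v] assms
    by (simp add: opA_def opB_def opC_def opD_def detq_def algebra_simps)
  finally show ?thesis .
qed

lemma transfer_polynomial:
  "\<exists>P. degree P < N \<and> (\<forall>x. \<T> x v s = poly P x)"
proof -
  obtain P Q where P: "degree P \<le> N" "coeff P N = 0" "\<And>x. B x v s = poly P x"
    and Q: "degree Q \<le> N" "coeff Q N = 0" "\<And>x. C x v s = poly Q x"
    using monodromy_polynomial[of N False True \<eta> \<xi> v s] monodromy_polynomial[of N True False \<eta> \<xi> v s]
    unfolding opB_def opC_def by auto
  have "degree (P + Q) < N"
    using P Q N_pos by (intro degree_less_if_coeff_0) (auto intro: degree_add_le)
  then show ?thesis using P(3) Q(3) by (intro exI[of _ "P + Q"]) (auto simp: antiperiodic_transfer_def)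
qed

text \<open>\<open>cov k h v\<close> is \<open>\<langle>0| \<Prod>\<^bsub>n<k, n\<in>h\<^esub> C(\<xi>\<^sub>n) |v\<rangle>\<close>; the basis covectors are \<open>cov N h\<close>.\<close>

primrec cov :: "nat \<Rightarrow> nat set \<Rightarrow> state \<Rightarrow> complex" where
  "cov 0 h v = v (replicate N False)"
| "cov (Suc k) h v = cov k h (if k \<in> h then C (\<xi> k) v else v)"

lemma cov_linear: "cov k h (\<lambda>s. a * f s + b * g s) = a * cov k h f + b * cov k h g"
proof (induction k arbitrary: f g)
  case (Suc k)
  have "C (\<xi> k) (\<lambda>s. a * f s + b * g s) = (\<lambda>s. a * C (\<xi> k) f s + b * C (\<xi> k) g s)"
    by (intro ext) (simp add: opC_def monodromy_linear)
  with Suc show ?case by simp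
qed simp

lemma cov_cong:
  "(\<And>s. length s = N \<Longrightarrow> v s = w s) \<Longrightarrow> cov k h v = cov k h w"
proof (induction k arbitrary: v w)
  case (Suc k)
  have "C x v s = C x w s" if "length s = N" for s x
    unfolding opC_def by (rule monodromy_cong) (use Suc.prems that in auto)
  with Suc.prems show ?case unfolding cov.simps by (intro Suc.IH) simp
qed simp

text \<open>RTT and its mirror image multiply the commutator by \<open>x - y + \<eta>\<close> and
  \<open>y - x + \<eta>\<close>, whose sum \<open>2 * \<eta>\<close> is nonzero.\<close>

lemma C_C: "C x (C y v) = C y (C x v)"
proof (cases "x = y")
  case False
  have "C x (C y v) s = C y (C x v) s" for s
  proof -
    have "(x - y + \<eta>) * (C x (C y v) s - C y (C x v) s) = 0"
      using RTT[of x y \<eta> \<xi> N True False True False v s]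
      by (simp add: opC_def algebra_simps)
    moreover have "(y - x + \<eta>) * (C x (C y v) s - C y (C x v) s) = 0"
      using RTT[of y x \<eta> \<xi> N True False True False v s]
      by (simp add: opC_def algebra_simps)
    moreover have "x - y + \<eta> \<noteq> 0 \<or> y - x + \<eta> \<noteq> 0"
      using eta_nonzero by algebra
    ultimately show ?thesis by auto
  qed
  then show ?thesis by auto
qed simp

text \<open>The next two relations are written as combinations of exactly two states on each side,
  so that \<open>cov_linear\<close> applies verbatim.\<close>

lemma C_D:
  "(\<lambda>s. (x - y) * C y (D x v) s + 0 * v s) =
   (\<lambda>s. (x - y + \<eta>) * D x (C y v) s + (- \<eta>) * D y (C x v) s)"
proof
  fix s
  show "(x - y) * C y (D x v) s + 0 * v s = (x - y + \<eta>) * D x (C y v) s + (- \<eta>) * D y (C x v) s"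
    using RTT[of x y \<eta> \<xi> N True True True False v s]
    by (simp add: opC_def opD_def algebra_simps)
qed

lemma C_B:
  "(\<lambda>s. (x - y) * C y (B x v) s + (- (x - y)) * B x (C y v) s) =
   (\<lambda>s. \<eta> * D x (opA \<eta> \<xi> N y v) s + (- \<eta>) * D y (opA \<eta> \<xi> N x v) s)"
proof
  fix s
  show "(x - y) * C y (B x v) s + (- (x - y)) * B x (C y v) s =
     \<eta> * D x (opA \<eta> \<xi> N y v) s + (- \<eta>) * D y (opA \<eta> \<xi> N x v) s"
    using RTT[of x y \<eta> \<xi> N False True True False v s]
    by (simp add: opA_def opB_def opC_def opD_def algebra_simps)
qed

section \<open>Action of B, C and D on the covectors\<close>

lemma vacuum:
  "B x v (replicate N False) = 0"
  "D x v (replicate N False) = d x * v (replicate N False)"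
  unfolding opB_def opD_def by (rule monodromy_vacuum; simp)+

text \<open>Moving D left past the C operators yields only D at nodes absent from the remaining
  factors; at the vacuum, \<open>d\<close> vanishes there.\<close>

lemma cov_D_node:
  assumes "n < N" "\<not> (n < k \<and> n \<in> h)" "k \<le> N"
  shows "cov k h (D (\<xi> n) v) = 0"
  using assms
proof (induction k arbitrary: n v)
  case 0
  then show ?case by (simp add: vacuum)
next
  case (Suc k)
  show ?case
  proof (cases "k \<in> h")
    case False
    with Suc show ?thesis by auto
  next
    case True
    with Suc.prems have "n \<noteq> k" "\<not> (n < k \<and> n \<in> h)" by auto
    with Suc.IH[of n] Suc.IH[of k] Suc.prems
    have "(\<xi> n - \<xi> k) * cov k h (C (\<xi> k) (D (\<xi> n) v)) = 0"
      using arg_cong[OF C_D[of "\<xi> n" "\<xi> k" v], of "cov k h"] unfolding cov_linear by simp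
    with True generic[of n k] \<open>n \<noteq> k\<close> Suc.prems show ?thesis by simp
  qed
qed

text \<open>The correction terms of \<open>C_B\<close> start with D at \<open>\<xi> n\<close> or
  \<open>\<xi> k\<close> and vanish by \<open>cov_D_node\<close>.\<close>

lemma cov_B_node:
  assumes "n < N" "\<not> (n < k \<and> n \<in> h)" "k \<le> N"
  shows "cov k h (B (\<xi> n) v) = 0"
  using assms
proof (induction k arbitrary: v)
  case 0
  then show ?case by (simp add: vacuum)
next
  case (Suc k)
  show ?case
  proof (cases "k \<in> h")
    case False
    with Suc show ?thesis by auto
  next
    case True
    with Suc.prems have "n \<noteq> k" "\<not> (n < k \<and> n \<in> h)" by auto
    with Suc.IH Suc.prems cov_D_node[of n k h] cov_D_node[of k k h]
    have "(\<xi> n - \<xi> k) * cov k h (C (\<xi> k) (B (\<xi> n) v)) = 0"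
      using arg_cong[OF C_B[of "\<xi> n" "\<xi> k" v], of "cov k h"] unfolding cov_linear by simp
    with True generic[of n k] \<open>n \<noteq> k\<close> Suc.prems show ?thesis by simp
  qed
qed

lemma cov_C_node:
  assumes "n < k" "n \<notin> h"
  shows "cov k h (C (\<xi> n) v) = cov k (insert n h) v"
  using assms
proof (induction k arbitrary: v)
  case (Suc k)
  have restrict: "(\<And>m. m < k \<Longrightarrow> m \<in> g \<longleftrightarrow> m \<in> h) \<Longrightarrow> cov k g v = cov k h v" for k g h v
    by (induction k arbitrary: v) auto
  show ?case
  proof (cases "n = k")
    case True
    with Suc.prems restrict[of k h "insert n h"] show ?thesis by simp
  next
    case False
    with Suc show ?thesis by (auto simp: C_C[of "\<xi> k" "\<xi> n"])
  qed
qed simp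

text \<open>The eigenvalue of \<open>D (\<xi> n - \<eta>)\<close> on \<open>cov k h\<close>: in the
  product \<open>d\<close>, nodes of \<open>h\<close> below \<open>k\<close> move to
  \<open>\<xi> m - \<eta>\<close>.\<close>

definition eigD :: "nat \<Rightarrow> nat set \<Rightarrow> nat \<Rightarrow> complex" where
  "eigD k h n = (\<Prod>m<N. \<xi> n - \<eta> - \<xi> m + (if m < k \<and> m \<in> h then \<eta> else 0))"

text \<open>Evaluating only at \<open>\<xi>\<^sub>n - \<eta>\<close> avoids the points \<open>\<xi>\<^sub>k\<close>, where \<open>C_D\<close> carries no information.\<close>

lemma cov_D_shifted:
  assumes "n < N" "k \<le> N"
  shows "cov k h (D (\<xi> n - \<eta>) v) = eigD k h n * cov k h v"
  using assms(2)
proof (induction k arbitrary: v)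
  case 0
  then show ?case by (simp add: vacuum eigD_def dfun_def)
next
  case (Suc k)
  show ?case
  proof (cases "k \<in> h")
    case False
    then have "eigD (Suc k) h n = eigD k h n"
      unfolding eigD_def by (intro prod.cong) (auto simp: less_Suc_eq)
    with False Suc show ?thesis by auto
  next
    case True
    define x where "x = \<xi> n - \<eta>"
    define r where "r = (\<Prod>m\<in>{..<N} - {k}. x - \<xi> m + (if m < k \<and> m \<in> h then \<eta> else 0))"
    have k: "k \<in> {..<N}" using Suc.prems by simp
    have r0: "eigD k h n = (x - \<xi> k) * r"
      unfolding eigD_def r_def x_def by (subst prod.remove[OF _ k]) auto
    have "r = (\<Prod>m\<in>{..<N} - {k}. x - \<xi> m + (if m < Suc k \<and> m \<in> h then \<eta> else 0))"
      unfolding r_def by (intro prod.cong) (auto simp: less_Suc_eq)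
    then have r1: "eigD (Suc k) h n = (x - \<xi> k + \<eta>) * r"
      unfolding eigD_def x_def using True by (subst prod.remove[OF _ k]) auto
    \<comment> \<open>The second term of \<open>C_D\<close> drops out, because the first
      \<open>k\<close> slots contain no factor at \<open>\<xi> k\<close>.\<close>
    have "cov k h (D (\<xi> k) (C x v)) = 0"
      using Suc.prems by (intro cov_D_node) auto
    then have "(x - \<xi> k) * cov k h (C (\<xi> k) (D x v)) =
        (x - \<xi> k) * ((x - \<xi> k + \<eta>) * r * cov k h (C (\<xi> k) v))"
      using arg_cong[OF C_D[of x "\<xi> k" v], of "cov k h"] Suc
      unfolding cov_linear by (simp add: x_def[symmetric] r0 mult_ac)
    moreover have "x - \<xi> k \<noteq> 0"
      using shifted_node_neq[of n k] assms Suc.prems by (auto simp: x_def)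
    ultimately show ?thesis using True by (simp add: r1 x_def)
  qed
qed

text \<open>The factor \<open>m = n\<close> is \<open>0\<close> or \<open>-\<eta>\<close> according
  to \<open>h\<close>; genericity keeps the others nonzero. These zeros tell the covectors
  apart.\<close>

lemma eigD_eq_0_iff:
  assumes "n < N" shows "eigD N h n = 0 \<longleftrightarrow> n \<in> h"
proof
  assume "n \<in> h"
  then show "eigD N h n = 0" using assms by (auto simp: eigD_def intro!: bexI[of _ n])
next
  assume "eigD N h n = 0"
  then obtain m where m: "m < N" "\<xi> n - \<eta> - \<xi> m + (if m \<in> h then \<eta> else 0) = 0"
    by (auto simp: eigD_def split: if_splits)
  show "n \<in> h"
    using m generic[of n m] shifted_node_neq[of n m] assms by (cases "n = m") (auto split: if_splits)
qed

text \<open>The quantum determinant gives CB = DA - det, and the covector kills the term with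
  \<open>D (\<xi> n)\<close>.\<close>

lemma cov_C_B:
  assumes "n < N" "n \<notin> h"
  shows "cov N h (C (\<xi> n) (B (\<xi> n - \<eta>) v)) = - detq n * cov N h v"
proof -
  let ?A = "opA \<eta> \<xi> N (\<xi> n - \<eta>) v"
  have "cov N h (C (\<xi> n) (B (\<xi> n - \<eta>) v)) = cov N h (\<lambda>s. 1 * D (\<xi> n) ?A s + (- detq n) * v s)"
  proof (rule cov_cong)
    fix s :: "bool list" assume "length s = N"
    then show "C (\<xi> n) (B (\<xi> n - \<eta>) v) s = 1 * D (\<xi> n) ?A s + (- detq n) * v s"
      using quantum_determinant[of N s \<eta> \<xi> "\<xi> n" True False v]
      by (simp add: opA_def opB_def opC_def opD_def detq_def algebra_simps)
  qed
  also have "\<dots> = - detq n * cov N h v"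
    unfolding cov_linear using assms by (simp add: cov_D_node)
  finally show ?thesis .
qed

lemma cov_transfer_node:
  assumes "n < N" "n \<notin> h"
  shows "cov N h (\<T> (\<xi> n) v) = cov N (insert n h) v"
  unfolding transfer_eq cov_linear using assms by (simp add: cov_B_node cov_C_node)

text \<open>Slot \<open>n\<close> can be traded for \<open>\<T> (\<xi> n)\<close>, which sets up the
  fusion identity.\<close>

lemma cov_transfer_shifted:
  assumes "n < N" "n \<notin> h"
  shows "cov N (insert n h) (\<T> (\<xi> n - \<eta>) v) = - detq n * cov N h v"
proof -
  have "cov N (insert n h) (\<T> (\<xi> n - \<eta>) v) = cov N h (\<T> (\<xi> n) (\<T> (\<xi> n - \<eta>) v))"
    using assms by (simp add: cov_transfer_node)
  also have "\<dots> = cov N h (\<lambda>s. (- detq n) * v s + 0 * v s)"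
    by (rule cov_cong) (use assms in \<open>simp add: fusion\<close>)
  finally show ?thesis unfolding cov_linear by simp
qed

section \<open>The covectors as a basis of the dual space\<close>

lemma finite_states: "finite {s :: bool list. length s = N}"
  using finite_lists_length_eq[of "UNIV :: bool set" N] by simp

definition basis_state :: "bool list \<Rightarrow> state" where
  "basis_state s = (\<lambda>t. if t = s then 1 else 0)"

lemma cov_expand:
  assumes "in_space N v"
  shows "cov N h v = (\<Sum>s | length s = N. cov N h (basis_state s) * v s)"
proof -
  have "cov N h (\<lambda>t. \<Sum>s\<in>S. v s * basis_state s t) = (\<Sum>s\<in>S. cov N h (basis_state s) * v s)"
    if "finite S" for S
    using that
  proof induction
    case empty
    show ?case using cov_linear[of N h 0 v 0 v] by simp
  next
    case (insert s S)
    then show ?case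
      using cov_linear[of N h "v s" "basis_state s" 1 "\<lambda>t. \<Sum>s\<in>S. v s * basis_state s t"] by simp
  qed
  moreover have "(\<Sum>s | length s = N. v s * basis_state s t) = v t" if "length t = N" for t
    using finite_states that by (simp add: basis_state_def if_distrib sum.delta cong: if_cong)
  then have "cov N h v = cov N h (\<lambda>t. \<Sum>s | length s = N. v s * basis_state s t)"
    by (intro cov_cong) auto
  ultimately show ?thesis using finite_states by simp
qed

lemma in_space_basis_state: "length s = N \<Longrightarrow> in_space N (basis_state s)"
  by (auto simp: in_space_def basis_state_def)

text \<open>From the vacuum state on, \<open>B (\<xi> n - \<eta>)\<close> turns a witness for
  \<open>h\<close> into one for \<open>insert n h\<close>.\<close>

lemma cov_nonzero:
  assumes "h \<subseteq> {..<N}"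
  shows "\<exists>w. in_space N w \<and> cov N h w \<noteq> 0"
  using finite_subset[OF assms finite_lessThan] assms
proof (induction h rule: finite_induct)
  case empty
  have "cov k {} v = v (replicate N False)" for k v by (induction k) auto
  then show ?case
    by (intro exI[of _ "basis_state (replicate N False)"]) (auto simp: in_space_basis_state, simp add: basis_state_def)
next
  case (insert n h)
  then obtain w where w: "in_space N w" "cov N h w \<noteq> 0" by auto
  have "cov N (insert n h) (B (\<xi> n - \<eta>) w) = - detq n * cov N h w"
    using insert cov_C_node[of n N h] cov_C_B[of n h w] by simp
  then show ?case
    using w insert.prems by (intro exI[of _ "B (\<xi> n - \<eta>) w"]) (auto simp: in_space_ops detq_nonzero)
qed

text \<open>Induction by inclusion: proper subsets of \<open>h\<close> already have coefficient
  zero, and a product of D operators removes all sets not contained in \<open>h\<close>.\<close>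

lemma cov_independent:
  assumes rel: "\<And>s. length s = N \<Longrightarrow> (\<Sum>h\<in>Pow {..<N}. a h * cov N h (basis_state s)) = 0"
    and h: "h \<subseteq> {..<N}"
  shows "a h = 0"
  using finite_subset[OF h finite_lessThan] h
proof (induction h rule: finite_psubset_induct)
  case (psubset h)
  have rel': "(\<Sum>g\<in>Pow {..<N}. a g * cov N g v) = 0" if "in_space N v" for v
  proof -
    have "(\<Sum>g\<in>Pow {..<N}. a g * cov N g v) =
        (\<Sum>g\<in>Pow {..<N}. \<Sum>s | length s = N. a g * cov N g (basis_state s) * v s)"
      using that by (simp add: cov_expand[of v] sum_distrib_left mult.assoc)
    also have "\<dots> = (\<Sum>s | length s = N. (\<Sum>g\<in>Pow {..<N}. a g * cov N g (basis_state s)) * v s)"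
      by (subst sum.swap) (simp add: sum_distrib_right)
    finally show ?thesis using rel by simp
  qed
  have project: "\<exists>v. in_space N v \<and> (\<forall>g. cov N g v = (\<Prod>n\<in>K. eigD N g n) * cov N g w)"
    if "finite K" "K \<subseteq> {..<N}" "in_space N w" for K w
    using that
  proof (induction K rule: finite_induct)
    case (insert n K)
    then obtain v where "in_space N v" "\<forall>g. cov N g v = (\<Prod>n\<in>K. eigD N g n) * cov N g w" by auto
    with insert show ?case
      by (intro exI[of _ "D (\<xi> n - \<eta>) v"]) (auto simp: in_space_ops cov_D_shifted)
  qed auto
  txt \<open>\<open>\<Prod>\<^bsub>n\<notin>h\<^esub> D(\<xi>\<^sub>n - \<eta>)\<close> kills every \<open>\<langle>g|\<close> with \<open>g\<close> not contained in \<open>h\<close>, and rescales \<open>\<langle>h|\<close>.\<close>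
  obtain w where w: "in_space N w" "cov N h w \<noteq> 0" using cov_nonzero psubset.prems by blast
  obtain v where v: "in_space N v" "\<And>g. cov N g v = (\<Prod>n\<in>{..<N} - h. eigD N g n) * cov N g w"
    using project[of "{..<N} - h" w] w by auto
  have "a g * cov N g v = 0" if g: "g \<subseteq> {..<N}" "g \<noteq> h" for g
  proof (cases "g \<subset> h")
    case True
    then show ?thesis using psubset that by auto
  next
    case False
    then obtain n where "n \<in> {..<N} - h" "n \<in> g" using g by blast
    then have "(\<Prod>n\<in>{..<N} - h. eigD N g n) = 0"
      by (intro prod_zero) (auto simp: eigD_eq_0_iff)
    then show ?thesis by (simp add: v)
  qed
  then have "(\<Sum>g\<in>Pow {..<N} - {h}. a g * cov N g v) = 0"
    by (intro sum.neutral) simp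
  then have "a h * cov N h v = 0"
    using rel'[OF v(1)] psubset.prems sum.remove[of "Pow {..<N}" h "\<lambda>g. a g * cov N g v"] by simp
  moreover have "cov N h v \<noteq> 0" using w by (auto simp: v eigD_eq_0_iff)
  ultimately show ?case by simp
qed

lemma card_index: "card (Pow {..<N}) = card {s :: bool list. length s = N}"
  using card_lists_length_eq[of "UNIV :: bool set" N] by (simp add: card_Pow)

text \<open>There are as many covectors as basis states, so independent rows give a trivial
  kernel.\<close>

lemma cov_matrix_injective:
  assumes "\<And>h. h \<subseteq> {..<N} \<Longrightarrow> (\<Sum>s | length s = N. cov N h (basis_state s) * v s) = 0" "length s = N"
  shows "v s = 0"
proof (rule independent_rows_imp_injective[OF _ finite_states card_index])
  fix a assume "\<And>s. s \<in> {s. length s = N} \<Longrightarrow> (\<Sum>h\<in>Pow {..<N}. a h * cov N h (basis_state s)) = 0"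
  then show "\<forall>h\<in>Pow {..<N}. a h = 0"
    using cov_independent[of a] by simp
qed (use assms in simp_all)

lemma cov_separates:
  assumes "in_space N v" "\<And>h. h \<subseteq> {..<N} \<Longrightarrow> cov N h v = 0"
  shows "v s = 0"
proof (cases "length s = N")
  case True
  then show ?thesis
    using assms(2) cov_matrix_injective[of v s] by (simp flip: cov_expand[OF assms(1)])
qed (use assms in \<open>simp add: in_space_def\<close>)

lemma cov_solvable: "\<exists>v. in_space N v \<and> (\<forall>h\<subseteq>{..<N}. cov N h v = b h)"
proof -
  have "\<exists>v. \<forall>h\<in>Pow {..<N}. (\<Sum>s | length s = N. cov N h (basis_state s) * v s) = b h"
  proof (rule injective_imp_solvable)
    fix v :: state
    assume "\<And>h. h \<in> Pow {..<N} \<Longrightarrow> (\<Sum>s | length s = N. cov N h (basis_state s) * v s) = 0"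
    then show "\<forall>s\<in>{s. length s = N}. v s = 0"
      using cov_matrix_injective[of v] by simp
  qed (simp_all add: card_index finite_states)
  then obtain v where v: "\<forall>h\<in>Pow {..<N}. (\<Sum>s | length s = N. cov N h (basis_state s) * v s) = b h" by blast
  \<comment> \<open>The linear system fixes \<open>v\<close> on lists of length \<open>N\<close>
    only; zero elsewhere puts it in the space.\<close>
  let ?v = "\<lambda>s. if length s = N then v s else 0"
  have in_v: "in_space N ?v" by (simp add: in_space_def)
  have "cov N h ?v = b h" if "h \<subseteq> {..<N}" for h
    unfolding cov_expand[OF in_v] using v that by simp
  with in_v show ?thesis by blast
qed

section \<open>Eigenvalues as solutions of the discrete equations\<close>

theorem eigenvalue_iff_discrete:
  "is_transfer_eigenvalue \<eta> \<xi> N \<tau> \<longleftrightarrow>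
    (\<exists>t. degree t < N \<and> \<tau> = poly t \<and> (\<forall>n<N. poly t (\<xi> n) * poly t (\<xi> n - \<eta>) = - detq n))"
proof
  assume "is_transfer_eigenvalue \<eta> \<xi> N \<tau>"
  then obtain v where v: "in_space N v" "v \<noteq> (\<lambda>s. 0)" "\<And>x. \<T> x v = (\<lambda>s. \<tau> x * v s)"
    by (auto simp: is_transfer_eigenvalue_def)
  then obtain s where s: "v s \<noteq> 0" by auto
  with v(1) have len: "length s = N" by (auto simp: in_space_def)
  obtain P where P: "degree P < N" "\<And>x. \<T> x v s = poly P x" using transfer_polynomial by blast
  \<comment> \<open>Any nonzero component of the eigenvector exhibits \<open>\<tau>\<close> as a
    polynomial.\<close>
  have t: "\<tau> = poly (smult (1 / v s) P)"
    using P(2) v(3) s by (auto simp: field_simps fun_eq_iff)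
  have "\<tau> (\<xi> n) * \<tau> (\<xi> n - \<eta>) = - detq n" if "n < N" for n
  proof -
    have "\<T> (\<xi> n) (\<lambda>s. \<tau> (\<xi> n - \<eta>) * v s + 0 * v s) s = \<tau> (\<xi> n - \<eta>) * \<T> (\<xi> n) v s"
      unfolding antiperiodic_transfer_def opB_def opC_def monodromy_linear by (simp add: algebra_simps)
    with fusion[OF that len, of v] have "\<tau> (\<xi> n) * \<tau> (\<xi> n - \<eta>) * v s = - detq n * v s"
      by (simp add: v(3) mult_ac)
    then show ?thesis by (simp only: mult_right_cancel[OF s])
  qed
  with t P(1) show "\<exists>t. degree t < N \<and> \<tau> = poly t \<and> (\<forall>n<N. poly t (\<xi> n) * poly t (\<xi> n - \<eta>) = - detq n)"
    by (intro exI[of _ "smult (1 / v s) P"]) (auto intro: le_less_trans[OF degree_smult_le])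
next
  assume "\<exists>t. degree t < N \<and> \<tau> = poly t \<and> (\<forall>n<N. poly t (\<xi> n) * poly t (\<xi> n - \<eta>) = - detq n)"
  then obtain t where t: "degree t < N" "\<tau> = poly t"
    and eq: "\<And>n. n < N \<Longrightarrow> poly t (\<xi> n) * poly t (\<xi> n - \<eta>) = - detq n" by blast
  obtain v where v: "in_space N v" "\<And>h. h \<subseteq> {..<N} \<Longrightarrow> cov N h v = (\<Prod>n\<in>h. poly t (\<xi> n))"
    using cov_solvable[of "\<lambda>h. \<Prod>n\<in>h. poly t (\<xi> n)"] by blast
  \<comment> \<open>The empty product gives \<open>cov N {} v = 1\<close>.\<close>
  have "v \<noteq> (\<lambda>s. 0)"
    using v(2)[of "{}"] cov_linear[of N "{}" 0 v 0 v] by auto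
  moreover have "\<T> x v s - poly t x * v s = 0" for x s
  proof (rule cov_separates[of "\<lambda>s. \<T> x v s - poly t x * v s"])
    show "in_space N (\<lambda>s. \<T> x v s - poly t x * v s)"
      using v(1) in_space_ops(4)[OF v(1), of x] by (auto simp: in_space_def)
  next
    fix h assume h: "h \<subseteq> {..<N}"
    \<comment> \<open>The \<open>N\<close> points where the action of \<open>\<T>\<close> on
      \<open>cov N h\<close> is known: nodes outside \<open>h\<close>, and shifted nodes of
      \<open>h\<close>.\<close>
    define pt where "pt n = \<xi> n - (if n \<in> h then \<eta> else 0)" for n
    obtain P where P: "\<And>s. degree (P s) < N" "\<And>s x. \<T> x v s = poly (P s) x"
      using transfer_polynomial[of v] by metis
    define Q where "Q = (\<Sum>s | length s = N. smult (cov N h (basis_state s)) (P s))"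
    have Q: "cov N h (\<T> x v) = poly Q x" for x
      using cov_expand[OF in_space_ops(4)[OF v(1)]] by (simp add: Q_def poly_sum P(2))
    have "degree Q < N" unfolding Q_def
      using N_pos P(1) by (intro degree_sum_less) (auto intro: le_less_trans[OF degree_smult_le])
    have inj: "inj_on pt {..<N}"
    proof (rule inj_onI)
      fix a b assume ab: "a \<in> {..<N}" "b \<in> {..<N}" "pt a = pt b"
      show "a = b"
      proof (rule ccontr)
        assume "a \<noteq> b"
        with generic[of a b] ab show False by (auto simp: pt_def algebra_simps split: if_splits)
      qed
    qed
    have "poly Q x = poly (smult (cov N h v) t) x" if x: "x \<in> pt ` {..<N}" for x
    proof -
      obtain n where n: "n < N" "x = pt n" using x by auto
      have fin: "finite h" using h finite_subset by blast
      show ?thesis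
      proof (cases "n \<in> h")
        case False
        then have "cov N h (\<T> x v) = (\<Prod>m\<in>insert n h. poly t (\<xi> m))"
          using n h by (simp add: pt_def cov_transfer_node v(2))
        with False fin h n show ?thesis unfolding Q by (simp add: v(2) pt_def)
      next
        case True
        \<comment> \<open>The shifted action empties slot \<open>n\<close>; the discrete equation
          then splits \<open>- detq n\<close> into two values of \<open>t\<close>, one of which
          refills the product over \<open>h\<close>.\<close>
        define g where "g = h - {n}"
        have g: "h = insert n g" "n \<notin> g" "g \<subseteq> {..<N}" "finite g" using True h fin by (auto simp: g_def)
        have "cov N h (\<T> x v) = - detq n * (\<Prod>m\<in>g. poly t (\<xi> m))"
          using n g True by (simp add: pt_def cov_transfer_shifted v(2))
        also have "\<dots> = poly t x * cov N h v"
          using eq[OF n(1)] g True n h by (simp add: v(2) pt_def mult.assoc[symmetric]) (simp add: mult_ac)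
        finally show ?thesis unfolding Q by (simp add: mult.commute)
      qed
    qed
    then have "Q = smult (cov N h v) t"
      using \<open>degree Q < N\<close> t(1) inj
      by (intro poly_eqI_degree[of "pt ` {..<N}"]) (auto simp: card_image intro: le_less_trans[OF degree_smult_le])
    then show "cov N h (\<lambda>s. \<T> x v s - poly t x * v s) = 0"
      using cov_linear[of N h 1 "\<T> x v" "- poly t x" v] by (simp add: Q)
  qed
  ultimately show "is_transfer_eigenvalue \<eta> \<xi> N \<tau>"
    unfolding is_transfer_eigenvalue_def t(2) using v(1) by (intro exI[of _ v]) (auto simp: fun_eq_iff)
qed

definition dpoly :: "complex poly" where
  "dpoly = (\<Prod>n<N. [:- \<xi> n, 1:])"

lemma poly_dpoly [simp]: "poly dpoly x = d x"
  by (simp add: dpoly_def dfun_def poly_prod)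

lemma degree_dpoly [simp]: "degree dpoly = N"
  unfolding dpoly_def by (subst degree_prod_sum_eq) auto

lemma coeff_dpoly [simp]: "coeff dpoly N = 1"
  using lead_coeff_prod[of "\<lambda>n. [:- \<xi> n, 1:]" "{..<N}"] degree_dpoly
  by (simp add: dpoly_def)

lemma node_inj: "inj_on \<xi> {..<N}"
  using generic by (auto simp: inj_on_def)

section \<open>The Baxter equation\<close>

text \<open>By the discrete equations, the condition on \<open>q\<close> at \<open>\<xi> n\<close>
  implies the one at \<open>\<xi> n - \<eta>\<close>, so \<open>N\<close> linear conditions secure
  \<open>2N\<close> zeros.\<close>

lemma TQ_solution:
  assumes t: "degree t < N" and disc: "\<And>n. n < N \<Longrightarrow> poly t (\<xi> n) * poly t (\<xi> n - \<eta>) = - detq n"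
  shows "\<exists>q. q \<noteq> 0 \<and> t * q = dpoly * shift \<eta> q - shift \<eta> dpoly * shift (- \<eta>) q"
proof -
  obtain a where a: "\<exists>u\<in>{..N}. a u \<noteq> 0"
    "\<And>n. n < N \<Longrightarrow> (\<Sum>u\<le>N. (poly t (\<xi> n) * \<xi> n ^ u + d (\<xi> n + \<eta>) * (\<xi> n - \<eta>) ^ u) * a u) = 0"
    using underdetermined_system[of "{..<N}" "{..N}" "\<lambda>n u. poly t (\<xi> n) * \<xi> n ^ u + d (\<xi> n + \<eta>) * (\<xi> n - \<eta>) ^ u"]
    by auto
  define q where "q = (\<Sum>u\<le>N. monom (a u) u)"
  have coeff_q: "coeff q u = (if u \<le> N then a u else 0)" for u
    by (simp add: q_def coeff_sum)
  have deg_q: "degree q \<le> N"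
    by (intro degree_le) (simp add: coeff_q)
  have q0: "q \<noteq> 0" using a(1) coeff_q by (metis atMost_iff coeff_0)
  have node: "poly t (\<xi> n) * poly q (\<xi> n) = - d (\<xi> n + \<eta>) * poly q (\<xi> n - \<eta>)" if "n < N" for n
  proof -
    have "poly t (\<xi> n) * poly q (\<xi> n) + d (\<xi> n + \<eta>) * poly q (\<xi> n - \<eta>) = 0"
      using a(2)[OF that]
      by (simp add: q_def poly_sum poly_monom sum_distrib_left sum.distrib[symmetric] algebra_simps)
    then show ?thesis by (simp add: eq_neg_iff_add_eq_0)
  qed
  have node': "poly t (\<xi> n - \<eta>) * poly q (\<xi> n - \<eta>) = d (\<xi> n - \<eta>) * poly q (\<xi> n)" if "n < N" for n
  proof -
    have "d (\<xi> n + \<eta>) * (poly t (\<xi> n - \<eta>) * poly q (\<xi> n - \<eta>)) = d (\<xi> n + \<eta>) * (d (\<xi> n - \<eta>) * poly q (\<xi> n))"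
      using node[OF that] disc[OF that] unfolding detq_def by algebra
    then show ?thesis using d_shifted_node_nonzero[OF that] by simp
  qed
  define E where "E = t * q - (dpoly * shift \<eta> q - shift \<eta> dpoly * shift (- \<eta>) q)"
  let ?Z = "\<xi> ` {..<N} \<union> (\<lambda>n. \<xi> n - \<eta>) ` {..<N}"
  \<comment> \<open>The two \<open>d\<close> products have equal coefficients here and
    \<open>t * q\<close> has smaller degree, so \<open>E\<close> has more zeros than its degree
    allows.\<close>
  have "coeff E (N + N) = 0"
    using t deg_q by (simp add: E_def coeff_mult_top coeff_shift_top coeff_eq_0)
  moreover have "degree E \<le> N + N"
    unfolding E_def
    by (intro degree_diff_le order_trans[OF degree_mult_le]) (use t deg_q in auto)
  ultimately have "degree E < N + N"
    using N_pos by (intro degree_less_if_coeff_0) auto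
  moreover have "card ?Z = N + N"
  proof -
    have "card ((\<lambda>n. \<xi> n - \<eta>) ` {..<N}) = N"
      using node_inj by (subst card_image) (auto simp: inj_on_def)
    moreover have "\<xi> ` {..<N} \<inter> (\<lambda>n. \<xi> n - \<eta>) ` {..<N} = {}"
      using shifted_node_neq by fastforce
    ultimately show ?thesis
      using node_inj by (subst card_Un_disjoint) (auto simp: card_image)
  qed
  moreover have "poly E x = poly 0 x" if "x \<in> ?Z" for x
    using that node node' by (auto simp: E_def)
  ultimately have "E = 0"
    using N_pos by (intro poly_eqI_degree[of ?Z]) auto
  with q0 show ?thesis by (auto simp: E_def)
qed

text \<open>Eliminating \<open>t\<close> gives \<open>d W(.+\<eta>) = d(.+\<eta>) W\<close>. The
  \<open>N\<close> distinct zeros of \<open>d\<close> are not zeros of \<open>d(.+\<eta>)\<close>,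
  so \<open>d\<close> divides \<open>W\<close>.\<close>

lemma Wronskian:
  assumes q: "q \<noteq> 0" "t * q = dpoly * shift \<eta> q - shift \<eta> dpoly * shift (- \<eta>) q"
    and p: "p \<noteq> 0" "- t * p = dpoly * shift \<eta> p - shift \<eta> dpoly * shift (- \<eta>) p"
  shows "degree p + degree q = N"
    and "p * shift (- \<eta>) q + q * shift (- \<eta>) p = smult (2 * lead_coeff p * lead_coeff q) dpoly"
proof -
  define W where "W = p * shift (- \<eta>) q + q * shift (- \<eta>) p"
  have shift_W: "shift \<eta> W = shift \<eta> p * q + shift \<eta> q * p"
    by (rule poly_ext) (simp add: W_def)
  have per: "dpoly * shift \<eta> W = shift \<eta> dpoly * W"
    unfolding shift_W unfolding W_def using q(2) p(2) by algebra
  \<comment> \<open>The two leading terms add instead of cancelling, which fixes both degree and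
    normalisation.\<close>
  have "coeff W (degree p + degree q) = 2 * lead_coeff p * lead_coeff q"
    using coeff_mult_top[of p "degree p" "shift (- \<eta>) q" "degree q"]
      coeff_mult_top[of q "degree q" "shift (- \<eta>) p" "degree p"]
    by (simp add: W_def coeff_shift_top add.commute)
  moreover have deg_le: "degree W \<le> degree p + degree q"
    unfolding W_def by (intro degree_add_le order_trans[OF degree_mult_le]) auto
  ultimately have deg_W: "degree W = degree p + degree q" and lead_W: "lead_coeff W = 2 * lead_coeff p * lead_coeff q"
    using p(1) q(1) by (metis le_antisym le_degree leading_coeff_0_iff mult_eq_0_iff zero_neq_numeral)+
  have nz: "dpoly \<noteq> 0" "shift \<eta> dpoly \<noteq> 0"
    using N_pos degree_dpoly degree_shift[of \<eta> dpoly] by (metis degree_0 not_one_le_zero)+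
  have "W mod dpoly = 0"
  proof (rule poly_eqI_degree[of "\<xi> ` {..<N}"])
    fix x assume "x \<in> \<xi> ` {..<N}"
    then obtain n where n: "n < N" "x = \<xi> n" by auto
    have "d (\<xi> n + \<eta>) * poly W (\<xi> n) = 0"
      using arg_cong[OF per, of "\<lambda>r. poly r (\<xi> n)"] n by simp
    then have "poly W x = 0" using d_shifted_node_nonzero[OF n(1)] n by simp
    moreover have "poly W x = poly (W div dpoly * dpoly + W mod dpoly) x" by (simp only: div_mult_mod_eq)
    ultimately show "poly (W mod dpoly) x = poly 0 x" using n by (simp del: div_mult_mod_eq)
  next
    show "degree (W mod dpoly) < card (\<xi> ` {..<N})"
      using degree_mod_less'[of dpoly W] N_pos nz node_inj
      by (cases "W mod dpoly = 0") (auto simp: card_image)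
  qed (use N_pos node_inj in \<open>auto simp: card_image\<close>)
  then obtain w where w: "W = dpoly * w" by (auto simp: mod_eq_0_iff_dvd elim: dvdE)
  have "shift \<eta> W = shift \<eta> dpoly * shift \<eta> w"
    by (rule poly_ext) (simp add: w)
  with per have "dpoly * shift \<eta> dpoly * shift \<eta> w = dpoly * shift \<eta> dpoly * w"
    by (simp add: w mult_ac)
  then have "shift \<eta> w = w" using nz by simp
  then obtain k where k: "w = [:k:]" using periodic_poly_constant eta_nonzero by blast
  then have Wk: "W = smult k dpoly" using w by simp
  moreover have "W \<noteq> 0" using lead_W p(1) q(1) by auto
  ultimately have "k \<noteq> 0" by auto
  then have "degree W = N" "lead_coeff W = k" by (auto simp: Wk)
  then show "degree p + degree q = N"
    and "p * shift (- \<eta>) q + q * shift (- \<eta>) p = smult (2 * lead_coeff p * lead_coeff q) dpoly"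
    using deg_W lead_W Wk by (auto simp: W_def)
qed

lemma discrete_imp_Wronskian_pair:
  assumes t: "degree t < N" and disc: "\<And>n. n < N \<Longrightarrow> poly t (\<xi> n) * poly t (\<xi> n - \<eta>) = - detq n"
  shows "\<exists>p q. degree p + degree q = N \<and> p * shift (- \<eta>) q + q * shift (- \<eta>) p = smult 2 dpoly \<and>
    smult 2 t = shift (- \<eta>) p * shift \<eta> q - shift (- \<eta>) q * shift \<eta> p"
proof -
  obtain q where q: "q \<noteq> 0" "t * q = dpoly * shift \<eta> q - shift \<eta> dpoly * shift (- \<eta>) q"
    using TQ_solution[OF t disc] by blast
  \<comment> \<open>The discrete equations are quadratic in \<open>t\<close>, so \<open>- t\<close>
    satisfies them too.\<close>
  obtain r where r: "r \<noteq> 0" "- t * r = dpoly * shift \<eta> r - shift \<eta> dpoly * shift (- \<eta>) r"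
    using TQ_solution[of "- t"] t disc by auto
  \<comment> \<open>Dividing \<open>r\<close> by \<open>c\<close> normalises the Wronskian to
    \<open>2 d\<close>.\<close>
  define c where "c = lead_coeff r * lead_coeff q"
  have c: "c \<noteq> 0" using q(1) r(1) by (simp add: c_def)
  define p where "p = smult (1 / c) r"
  have shift_p: "shift a p = smult (1 / c) (shift a r)" for a
    by (simp add: p_def shift_def pcompose_smult)
  have deg: "degree p + degree q = N" using Wronskian(1)[OF q r] c by (simp add: p_def)
  have "p * shift (- \<eta>) q + q * shift (- \<eta>) p = smult (1 / c) (r * shift (- \<eta>) q + q * shift (- \<eta>) r)"
    by (simp add: shift_p smult_add_right) (simp add: p_def)
  also have "\<dots> = smult 2 dpoly"
    unfolding Wronskian(2)[OF q r] using c by (simp add: c_def mult.assoc)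
  finally have W: "p * shift (- \<eta>) q + q * shift (- \<eta>) p = smult 2 dpoly" .
  have W': "shift \<eta> p * q + shift \<eta> q * p = smult 2 (shift \<eta> dpoly)"
  proof (rule poly_ext)
    fix x
    show "poly (shift \<eta> p * q + shift \<eta> q * p) x = poly (smult 2 (shift \<eta> dpoly)) x"
      using arg_cong[OF W, of "\<lambda>r. poly r (x + \<eta>)"] by simp
  qed
  \<comment> \<open>Both \<open>d\<close> factors of the Baxter equation are replaced through the
    Wronskian; the terms with unshifted \<open>p\<close> cancel and a factor \<open>q\<close>
    remains.\<close>
  have "smult 2 t * q = (shift (- \<eta>) p * shift \<eta> q - shift (- \<eta>) q * shift \<eta> p) * q"
  proof -
    have "smult 2 t * q = smult 2 dpoly * shift \<eta> q - smult 2 (shift \<eta> dpoly) * shift (- \<eta>) q"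
      by (simp add: q(2) smult_diff_right)
    also have "\<dots> = (shift (- \<eta>) p * shift \<eta> q - shift (- \<eta>) q * shift \<eta> p) * q"
      unfolding W[symmetric] W'[symmetric] by (simp add: algebra_simps)
    finally show ?thesis .
  qed
  then have "smult 2 t = shift (- \<eta>) p * shift \<eta> q - shift (- \<eta>) q * shift \<eta> p"
    using q(1) mult_right_cancel by blast
  with deg W show ?thesis by blast
qed

text \<open>The leading terms of the two products in \<open>t\<close> cancel. At a node
  \<open>p(x) q(x - \<eta>) = - q(x) p(x - \<eta>)\<close>, which turns the product of the two
  values of \<open>t\<close> into a product of two Wronskians.\<close>

lemma Wronskian_pair_imp_discrete:
  assumes deg: "degree p + degree q = N"
    and W: "\<And>x. (poly p x * poly q (x - \<eta>) + poly q x * poly p (x - \<eta>)) / 2 = d x"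
    and \<sigma>: "\<sigma> = 1 \<or> \<sigma> = -1"
    and t: "t = smult (\<sigma> / 2) (shift (- \<eta>) p * shift \<eta> q - shift (- \<eta>) q * shift \<eta> p)"
  shows "degree t < N" and "n < N \<Longrightarrow> poly t (\<xi> n) * poly t (\<xi> n - \<eta>) = - detq n"
proof -
  let ?t = "shift (- \<eta>) p * shift \<eta> q - shift (- \<eta>) q * shift \<eta> p"
  have "coeff ?t N = 0"
    using coeff_mult_top[of "shift (- \<eta>) p" "degree p" "shift \<eta> q" "degree q"]
      coeff_mult_top[of "shift (- \<eta>) q" "degree q" "shift \<eta> p" "degree p"] deg
    by (simp add: coeff_shift_top add.commute)
  moreover have "degree ?t \<le> N"
    by (intro degree_diff_le order_trans[OF degree_mult_le]) (use deg in auto)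
  ultimately have "degree ?t < N"
    using N_pos by (intro degree_less_if_coeff_0) auto
  then show "degree t < N" unfolding t by (rule le_less_trans[OF degree_smult_le])
  assume n: "n < N"
  let ?x = "\<xi> n"
  have sq: "\<sigma> * \<sigma> = 1" using \<sigma> by auto
  have W0: "poly p ?x * poly q (?x - \<eta>) = - (poly q ?x * poly p (?x - \<eta>))"
    using W[of ?x] n by (simp add: eq_neg_iff_add_eq_0)
  have d1: "d (?x + \<eta>) = (poly p (?x + \<eta>) * poly q ?x + poly q (?x + \<eta>) * poly p ?x) / 2"
    using W[of "?x + \<eta>"] by simp
  have d2: "d (?x - \<eta>) = (poly p (?x - \<eta>) * poly q (?x - \<eta> - \<eta>) + poly q (?x - \<eta>) * poly p (?x - \<eta> - \<eta>)) / 2"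
    using W[of "?x - \<eta>"] by simp
  have t1: "poly t ?x = \<sigma> / 2 * (poly p (?x - \<eta>) * poly q (?x + \<eta>) - poly q (?x - \<eta>) * poly p (?x + \<eta>))"
    by (simp add: t)
  have t2: "poly t (?x - \<eta>) = \<sigma> / 2 * (poly p (?x - \<eta> - \<eta>) * poly q ?x - poly q (?x - \<eta> - \<eta>) * poly p ?x)"
    by (simp add: t)
  show "poly t ?x * poly t (?x - \<eta>) = - detq n"
    unfolding detq_def d1 d2 t1 t2 using W0 sq by (simp add: field_simps) algebra
qed

end

theorem theorem4:
  fixes N :: nat and \<eta> :: complex and \<xi> :: "nat \<Rightarrow> complex" and \<tau> :: "complex \<Rightarrow> complex"
  assumes "N \<ge> 1" and "\<eta> \<noteq> 0"
    and "\<And>a b. a < N \<Longrightarrow> b < N \<Longrightarrow> a \<noteq> b \<Longrightarrow>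
           \<xi> a \<noteq> \<xi> b \<and> \<xi> a \<noteq> \<xi> b + \<eta> \<and> \<xi> a \<noteq> \<xi> b - \<eta>"
  shows "is_transfer_eigenvalue \<eta> \<xi> N \<tau> \<longleftrightarrow>
    (\<exists>(\<sigma>::complex) (p::complex poly) (q::complex poly) (R::nat).
       (\<sigma> = 1 \<or> \<sigma> = -1) \<and> R \<le> N div 2 \<and> degree q = R \<and> degree p = N - R \<and>
       (\<forall>x. \<tau> x = \<sigma> / 2 * (poly p (x - \<eta>) * poly q (x + \<eta>)
                              - poly q (x - \<eta>) * poly p (x + \<eta>))) \<and>
       (\<forall>x. (poly p x * poly q (x - \<eta>) + poly q x * poly p (x - \<eta>)) / 2 = dfun \<xi> N x))"
    (is "_ \<longleftrightarrow> ?rhs")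
proof -
  interpret inhomogeneous_chain N \<eta> \<xi> by unfold_locales (use assms in auto)
  show ?thesis
  proof
    assume "is_transfer_eigenvalue \<eta> \<xi> N \<tau>"
    then obtain t where t: "degree t < N" "\<tau> = poly t"
      "\<And>n. n < N \<Longrightarrow> poly t (\<xi> n) * poly t (\<xi> n - \<eta>) = - detq n"
      unfolding eigenvalue_iff_discrete by blast
    obtain p q where deg: "degree p + degree q = N"
      and W: "p * shift (- \<eta>) q + q * shift (- \<eta>) p = smult 2 dpoly"
      and tpq: "smult 2 t = shift (- \<eta>) p * shift \<eta> q - shift (- \<eta>) q * shift \<eta> p"
      using discrete_imp_Wronskian_pair[OF t(1,3)] by blast
    have W': "poly p x * poly q (x - \<eta>) + poly q x * poly p (x - \<eta>) = 2 * d x" for x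
      using arg_cong[OF W, of "\<lambda>r. poly r x"] by simp
    have t': "2 * \<tau> x = poly p (x - \<eta>) * poly q (x + \<eta>) - poly q (x - \<eta>) * poly p (x + \<eta>)" for x
      using arg_cong[OF tpq, of "\<lambda>r. poly r x"] t(2) by simp
    show ?rhs
    proof (cases "degree q \<le> N div 2")
      case True
      then show ?thesis
        using deg W' t' by (intro exI[of _ 1] exI[of _ p] exI[of _ q] exI[of _ "degree q"]) (auto simp flip: t')
    next
      case False
      \<comment> \<open>The degrees add up to \<open>N\<close>, so now \<open>p\<close> meets the
        bound; swapping \<open>p\<close> and \<open>q\<close> preserves the Wronskian and flips the
        sign of \<open>\<tau>\<close>.\<close>
      then show ?thesis
        using deg W' t'
        by (intro exI[of _ "-1"] exI[of _ q] exI[of _ p] exI[of _ "degree p"])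
          (auto simp: field_simps)
    qed
  next
    assume ?rhs
    then obtain \<sigma> p q R where *: "\<sigma> = 1 \<or> \<sigma> = -1" "R \<le> N div 2" "degree q = R" "degree p = N - R"
       "\<And>x. \<tau> x = \<sigma> / 2 * (poly p (x - \<eta>) * poly q (x + \<eta>) - poly q (x - \<eta>) * poly p (x + \<eta>))"
       "\<And>x. (poly p x * poly q (x - \<eta>) + poly q x * poly p (x - \<eta>)) / 2 = dfun \<xi> N x"
      by blast
    let ?t = "smult (\<sigma> / 2) (shift (- \<eta>) p * shift \<eta> q - shift (- \<eta>) q * shift \<eta> p)"
    have "degree p + degree q = N" using *(2-4) by simp
    note disc = Wronskian_pair_imp_discrete[OF this *(6,1) refl]
    have "\<tau> = poly ?t" by (auto simp: *(5))
    then show "is_transfer_eigenvalue \<eta> \<xi> N \<tau>"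
      unfolding eigenvalue_iff_discrete using disc by blast
  qed
qed

end
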